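(* Let $\pi\in\{2143,2413,3142,3412\}$ and let $p=(\pi,R)$ with $R=(\{0,4\}\times[4])\cup([4]\times\{0,4\})$ (exactly the boundary boxes shaded). Then for every $n\ge4$, \[ s_n^+(p)=\binom{n-2}{2}^2(n-4)!\qquad\text{and}\qquad\lim_{n\to\infty}\frac{s_n^+(p)}{n!}=\frac14. \]
   Context: For $n\ge1$, $S_n$ is the set of permutations of $\{1,\dots,n\}$ in one-line notation $\tau=\tau_1\cdots\tau_n$. For an integer $k\ge0$ write $[k]=\{0,1,\dots,k\}$. A mesh pattern of length $k$ is a pair $(\pi,R)$ with $\pi\in S_k$ and $R\subseteq[k]\times[k]$; the elements $(x,y)\in R$ are the shaded boxes (box $(x,y)$ is the unit square with south-west corner $(x,y)$ in the plot of the points $(i,\pi_i)$). An occurrence of $(\pi,R)$ in $\tau\in S_n$ is a choice of positions $i_1<\dots<i_k$ such that $\tau_{i_a}<\tau_{i_b}$ iff $\pi_a<\pi_b$ for all $a,b$, and such that for every $(x,y)\in R$ there is no index $m$ with $i_x<m<i_{x+1}$ and $v_y<\tau_m<v_{y+1}$, where $i_0=0$, $i_{k+1}=n+1$, $v_0=0$, $v_{k+1}=n+1$, and for $1\le y\le k$, $v_y$ is the $y$-th smallest of the values $\tau_{i_1},\dots,\tau_{i_k}$. A permutation contains a mesh pattern if it has at least one occurrence of it, and $s_n^+(p)$ denotes the number of permutations in $S_n$ containing $p$. *)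

theory Defs
  imports "HOL-Analysis.Analysis" "HOL-Combinatorics.Multiset_Permutations"
begin

text \<open>
  Permutations of \<open>{1..n}\<close> are lists in one-line notation, i.e. elements of
  \<^term>\<open>permutations_of_set {1..n}\<close>. Positions are 1-based, as in the usual plot of a
  permutation, whereas list indexing is 0-based; hence the shift in \<open>entry\<close>.
\<close>

definition entry :: "nat list \<Rightarrow> nat \<Rightarrow> nat" where
  "entry \<tau> i = \<tau> ! (i - 1)"

type_synonym mesh_pattern = "nat list \<times> (nat \<times> nat) set"

definition is_mesh_pattern :: "mesh_pattern \<Rightarrow> bool" where
  "is_mesh_pattern = (\<lambda>(\<pi>, R).
     \<pi> \<in> permutations_of_set {1..length \<pi>} \<and> R \<subseteq> {0..length \<pi>} \<times> {0..length \<pi>})"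

text \<open>
  For a list \<open>[a\<^sub>1, \<dots>, a\<^sub>k]\<close>, \<open>grid n\<close> adds \<open>a\<^sub>0 = 0\<close> and \<open>a\<^sub>k\<^sub>+\<^sub>1 = n + 1\<close>, so that
  \<open>grid n as ! x\<close> is \<open>a\<^sub>x\<close> for all \<open>x \<le> k + 1\<close>.
\<close>

definition grid :: "nat \<Rightarrow> nat list \<Rightarrow> nat list" where
  "grid n as = 0 # as @ [n + 1]"

text \<open>
  An occurrence is given by the increasing list \<open>is\<close> of its positions \<open>i\<^sub>1 < \<dots> < i\<^sub>k\<close>. The
  \<open>y\<close>-th smallest value \<open>v\<^sub>y\<close> is obtained by sorting the values at these positions.
\<close>

definition occurrence :: "mesh_pattern \<Rightarrow> nat list \<Rightarrow> nat list \<Rightarrow> bool" where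
  "occurrence = (\<lambda>(\<pi>, R) \<tau> is.
     let k = length \<pi>; n = length \<tau>; i = (!) (grid n is);
         v = (!) (grid n (sort (map (entry \<tau>) is)))
     in length is = k \<and> sorted_wrt (<) is \<and> set is \<subseteq> {1..n} \<and>
        (\<forall>a\<in>{1..k}. \<forall>b\<in>{1..k}. entry \<tau> (i a) < entry \<tau> (i b) \<longleftrightarrow> entry \<pi> a < entry \<pi> b) \<and>
        (\<forall>(x, y)\<in>R. \<not> (\<exists>m\<in>{1..n}. i x < m \<and> m < i (x + 1) \<and>
                                   v y < entry \<tau> m \<and> entry \<tau> m < v (y + 1))))"

definition contains :: "nat list \<Rightarrow> mesh_pattern \<Rightarrow> bool" where
  "contains \<tau> p \<longleftrightarrow> (\<exists>is. occurrence p \<tau> is)"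

definition num_containing :: "nat \<Rightarrow> mesh_pattern \<Rightarrow> nat" where
  "num_containing n p = card {\<tau> \<in> permutations_of_set {1..n}. contains \<tau> p}"

lemma is_mesh_pattern_boundary:
  assumes "\<pi> \<in> {[2,1,4,3], [2,4,1,3], [3,1,4,2], [3,4,1,2]}"
  shows "is_mesh_pattern (\<pi>, ({0, 4} \<times> {0..4}) \<union> ({0..4} \<times> {0, 4}))"
  using assms by (auto simp: is_mesh_pattern_def permutations_of_set_def)

end

theory Submission
  imports Defs "HOL-Real_Asymp.Real_Asymp"
begin

text \<open>
  Shading the boundary forces an occurrence to use the first and the last entry as well as the
  values \<open>1\<close> and \<open>n\<close>. Each of the four patterns is therefore described by the pair of the two
  outer entries and by the pair of the positions of \<open>1\<close> and \<open>n\<close>, each pair ranging over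
  \<open>{2..n-1}\<close> with a prescribed order of its components; the remaining \<open>n - 4\<close> entries are
  arbitrary.
\<close>

section \<open>Permutations with prescribed values\<close>

text \<open>The complements of \<open>I\<close> and of its image under \<open>g\<close> in
  \<open>S\<close> have the same size, so some bijection \<open>g'\<close> between them exists;
  gluing it to \<open>g\<close> and taking the identity outside \<open>S\<close> gives
  \<open>h\<close>.\<close>

lemma extend_inj_on_to_permutes:
  assumes "finite S" "I \<subseteq> S" "inj_on g I" "g ` I \<subseteq> S"
  obtains h where "h permutes S" "\<And>x. x \<in> I \<Longrightarrow> h x = g x"
proof -
  have "finite I" "finite (g ` I)"
    using assms finite_subset by auto
  then have "card (S - I) = card (S - g ` I)"
    using assms by (simp add: card_Diff_subset card_image)
  then obtain g' where g': "bij_betw g' (S - I) (S - g ` I)"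
    using assms(1) finite_same_card_bij[of "S - I" "S - g ` I"] by auto
  define h where "h x = (if x \<in> I then g x else if x \<in> S then g' x else x)" for x
  have "bij_betw h I (g ` I)"
    using assms(3) by (auto simp: h_def bij_betw_def inj_on_def)
  moreover have "bij_betw h (S - I) (S - g ` I)"
    using g' by (subst bij_betw_cong[where g = g']) (auto simp: h_def)
  ultimately have "bij_betw h (I \<union> (S - I)) (g ` I \<union> (S - g ` I))"
    by (intro bij_betw_combine) auto
  then have "bij_betw h S S"
    using assms by (simp add: Un_absorb1)
  then have "h permutes S"
    using assms(2) by (intro bij_imp_permutes) (auto simp: h_def)
  then show thesis
    by (rule that) (simp add: h_def)
qed

text \<open>Fix one extension \<open>h\<close> of the prescribed values. Left composition with
  \<open>h\<close> maps the permutations that fix \<open>I\<close> pointwise, that is, the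
  permutations of \<open>S - I\<close>, bijectively onto those that agree with \<open>g\<close> on
  \<open>I\<close>.\<close>

lemma card_permutes_prescribed:
  assumes "finite S" "I \<subseteq> S" "inj_on g I" "g ` I \<subseteq> S"
  shows "card {f. f permutes S \<and> (\<forall>x\<in>I. f x = g x)} = fact (card S - card I)"
proof -
  obtain h where h: "h permutes S" "\<And>x. x \<in> I \<Longrightarrow> h x = g x"
    using extend_inj_on_to_permutes assms by blast
  have hh: "h \<circ> inv h = id" "inv h \<circ> h = id"
    using permutes_inv_o[OF h(1)] by auto
  have "bij_betw (\<lambda>f. h \<circ> f) {f. f permutes (S - I)} {f. f permutes S \<and> (\<forall>x\<in>I. f x = g x)}"
  proof (rule bij_betw_byWitness[where f' = "\<lambda>f. inv h \<circ> f"])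
    show "(\<lambda>f. h \<circ> f) ` {f. f permutes (S - I)} \<subseteq> {f. f permutes S \<and> (\<forall>x\<in>I. f x = g x)}"
    proof safe
      fix f assume f: "f permutes (S - I)"
      then have "f permutes S"
        by (rule permutes_subset) auto
      then show "(h \<circ> f) permutes S"
        using h(1) by (rule permutes_compose)
      show "(h \<circ> f) x = g x" if "x \<in> I" for x
        using that h(2) permutes_not_in[OF f] by simp
    qed
    show "(\<lambda>f. inv h \<circ> f) ` {f. f permutes S \<and> (\<forall>x\<in>I. f x = g x)} \<subseteq> {f. f permutes (S - I)}"
    proof safe
      fix f assume f: "f permutes S" "\<forall>x\<in>I. f x = g x"
      have "(inv h \<circ> f) permutes S"
        by (rule permutes_compose[OF f(1) permutes_inv[OF h(1)]])
      moreover have "(inv h \<circ> f) x = x" if "x \<in> S - (S - I)" for x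
        using that f(2) h(2)[of x] permutes_inverses(2)[OF h(1), of x] by simp
      ultimately show "(inv h \<circ> f) permutes (S - I)"
        by (rule permutes_superset)
    qed
  qed (simp_all add: o_assoc hh)
  then have "card {f. f permutes S \<and> (\<forall>x\<in>I. f x = g x)} = card {f. f permutes (S - I)}"
    by (rule bij_betw_same_card[symmetric])
  also have "\<dots> = fact (card (S - I))"
    using assms(1) by (intro card_permutations) auto
  also have "card (S - I) = card S - card I"
    using assms(1,2) by (intro card_Diff_subset) (auto intro: finite_subset)
  finally show ?thesis .
qed

section \<open>From one-line words to permuting functions\<close>

text \<open>A function that is the identity off \<open>set xs\<close> is determined by its values
  along \<open>xs\<close>, which gives injectivity. Surjectivity then follows because both sides
  have the same finite cardinality.\<close>

lemma bij_betw_permutes_permutations_of_set: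
  assumes "distinct xs"
  shows "bij_betw (\<lambda>f. map f xs) {f. f permutes set xs} (permutations_of_set (set xs))"
proof -
  have inj: "inj_on (\<lambda>f. map f xs) {f. f permutes set xs}"
  proof (rule inj_onI, clarify, rule ext)
    fix f g x assume "f permutes set xs" "g permutes set xs" "map f xs = map g xs"
    then show "f x = g x"
      by (cases "x \<in> set xs") (auto simp: permutes_not_in)
  qed
  have "(\<lambda>f. map f xs) ` {f. f permutes set xs} \<subseteq> permutations_of_set (set xs)"
  proof clarify
    fix f assume f: "f permutes set xs"
    show "map f xs \<in> permutations_of_set (set xs)"
      using assms permutes_image[OF f] permutes_inj_on[OF f]
      by (intro permutations_of_setI) (simp_all add: distinct_map)
  qed
  moreover have "card ((\<lambda>f. map f xs) ` {f. f permutes set xs}) =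
                 card (permutations_of_set (set xs))"
    using inj by (simp add: card_image card_permutations)
  ultimately have "(\<lambda>f. map f xs) ` {f. f permutes set xs} = permutations_of_set (set xs)"
    by (intro card_subset_eq) auto
  with inj show ?thesis
    by (simp add: bij_betw_def)
qed

text \<open>This turns the count of lists into a count of functions, to which
  \<open>card_permutes_prescribed\<close> applies.\<close>

lemma num_containing_eq_card_permutes:
  "num_containing n p = card {f. f permutes {1..n} \<and> contains (map f [1..<Suc n]) p}"
proof -
  have "bij_betw (\<lambda>f. map f [1..<Suc n]) {f. f permutes {1..n}} (permutations_of_set {1..n})"
    using bij_betw_permutes_permutations_of_set[of "[1..<Suc n]"]
    by (simp add: atLeastLessThanSuc_atLeastAtMost del: upt_Suc)
  then have "bij_betw (\<lambda>f. map f [1..<Suc n])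
      {f \<in> {f. f permutes {1..n}}. contains (map f [1..<Suc n]) p}
      {\<tau> \<in> permutations_of_set {1..n}. contains \<tau> p}"
    by (auto simp: bij_betw_def inj_on_def simp del: upt_Suc)
  then show ?thesis
    unfolding num_containing_def by (simp add: bij_betw_same_card del: upt_Suc)
qed

lemma entry_map_upt:
  "m \<in> {1..n} \<Longrightarrow> entry (map f [1..<Suc n]) m = f m"
  by (auto simp: entry_def simp del: upt_Suc)

section \<open>Occurrences of a pattern with shaded boundary\<close>

lemma atLeastAtMost_1_4: "{1..4::nat} = {1, 2, 3, 4}" and
  atLeastAtMost_0_4: "{0..4::nat} = {0, 1, 2, 3, 4}"
  by auto

text \<open>The shaded boundary confines every point of the permutation to the bounding box of the
  occurrence. Since positions 1 and n and values 1 and n all occur, the box is the whole square.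
  Conversely, when the box is the whole square, the boundary boxes have empty interior or lie
  outside the plot.\<close>

lemma occurrence_boundary_iff:
  fixes \<pi> :: "nat list"
  defines "R \<equiv> ({0, 4} \<times> {0..4}) \<union> ({0..4} \<times> {0, 4})"
  assumes f: "f permutes {1..n}" and len: "length \<pi> = 4"
  shows "occurrence (\<pi>, R) (map f [1..<Suc n]) [i, j, k, l] \<longleftrightarrow>
    i = 1 \<and> l = n \<and> 1 < j \<and> j < k \<and> k < n \<and> {1, n} \<subseteq> f ` {i, j, k, l} \<and>
    (\<forall>a<4. \<forall>b<4. f ([i, j, k, l] ! a) < f ([i, j, k, l] ! b) \<longleftrightarrow> \<pi> ! a < \<pi> ! b)"
    (is "_ \<longleftrightarrow> ?rhs")
proof -
  define \<tau> where "\<tau> = map f [1..<Suc n]"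
  let ?is = "[i, j, k, l]"
  have range: "f m \<in> {1..n}" if "m \<in> {1..n}" for m
    using permutes_in_image[OF f] that by blast
  have f_eq: "f x = f y \<longleftrightarrow> x = y" for x y
    using permutes_inj[OF f] by (auto dest: injD)
  have len_\<tau>: "length \<tau> = n"
    by (simp add: \<tau>_def)
  \<comment> \<open>First the case of genuine positions, where \<open>entry\<close> agrees with
    \<open>f\<close>. For any other list both sides fail, as shown at the end.\<close>
  have main: "occurrence (\<pi>, R) \<tau> ?is \<longleftrightarrow> ?rhs" if pos: "1 \<le> i" "i < j" "j < k" "k < l" "l \<le> n"
  proof -
    have ent: "entry \<tau> m = f m" if "m \<in> {1..n}" for m
      unfolding \<tau>_def using that by (rule entry_map_upt)
    define w where "w = sort (map (entry \<tau>) ?is)"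
    have "map (entry \<tau>) ?is = map f ?is"
      using pos by (simp add: ent)
    then have w_map: "w = sort (map f ?is)"
      unfolding w_def by (rule arg_cong)
    have "length w = 4"
      unfolding w_map length_sort by simp
    then obtain w1 w2 w3 w4 where w: "w = [w1, w2, w3, w4]"
      by (auto simp: length_Suc_conv numeral_eq_Suc)
    have set_w: "{w1, w2, w3, w4} = f ` {i, j, k, l}"
      using w_map w by (metis list.set(1,2) set_map set_sort)
    have "sorted w"
      unfolding w_map by (rule sorted_sort)
    moreover have "distinct w"
      unfolding w_map distinct_sort using pos by (simp add: f_eq)
    ultimately have w_less: "w1 < w2" "w2 < w3" "w3 < w4"
      by (auto simp: w)
    have w_range: "1 \<le> w1" "w4 \<le> n"
    proof -
      have "{w1, w2, w3, w4} \<subseteq> {1..n}"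
        unfolding set_w using range pos by auto
      then show "1 \<le> w1" "w4 \<le> n" by auto
    qed
    have order: "(\<forall>a\<in>{1..4}. \<forall>b\<in>{1..4}.
          entry \<tau> (grid n ?is ! a) < entry \<tau> (grid n ?is ! b) \<longleftrightarrow> entry \<pi> a < entry \<pi> b)
      \<longleftrightarrow> (\<forall>a<4. \<forall>b<4. f (?is ! a) < f (?is ! b) \<longleftrightarrow> \<pi> ! a < \<pi> ! b)" (is "?A \<longleftrightarrow> ?B")
    proof -
      have "?A \<longleftrightarrow> (\<forall>a\<in>{1..4}. \<forall>b\<in>{1..4}. f (?is ! (a - 1)) < f (?is ! (b - 1))
              \<longleftrightarrow> \<pi> ! (a - 1) < \<pi> ! (b - 1))"
        unfolding atLeastAtMost_1_4 using pos by (simp add: grid_def ent entry_def[of \<pi>])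
      \<comment> \<open>Writing the index range as an image of \<open>Suc\<close> cancels the shift
        between 1-based pattern indices and 0-based list indices.\<close>
      also have "\<dots> \<longleftrightarrow> (\<forall>a\<in>Suc ` {..<4}. \<forall>b\<in>Suc ` {..<4}. f (?is ! (a - 1)) < f (?is ! (b - 1))
              \<longleftrightarrow> \<pi> ! (a - 1) < \<pi> ! (b - 1))"
        by (simp add: image_Suc_lessThan)
      also have "\<dots> \<longleftrightarrow> ?B"
        by auto
      finally show ?thesis .
    qed
    have shade: "(\<forall>(x, y)\<in>R. \<not> (\<exists>m\<in>{1..n}. grid n ?is ! x < m \<and> m < grid n ?is ! (x + 1) \<and>
            grid n w ! y < entry \<tau> m \<and> entry \<tau> m < grid n w ! (y + 1)))
      \<longleftrightarrow> i = 1 \<and> l = n \<and> w1 = 1 \<and> w4 = n" (is "?A \<longleftrightarrow> ?B")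
    proof
      assume A: ?A
      \<comment> \<open>A point of the occurrence lies in the bounding box by definition. Any other
        point avoids all grid lines, so it sits in the interior of some box \<open>(x, y)\<close>;
        that box is unshaded, hence both coordinates are in \<open>{1, 2, 3}\<close>.\<close>
      have inside: "i \<le> m \<and> m \<le> l \<and> w1 \<le> f m \<and> f m \<le> w4" if m: "m \<in> {1..n}" for m
      proof (cases "m \<in> {i, j, k, l}")
        case True
        then have "f m \<in> {w1, w2, w3, w4}"
          unfolding set_w by blast
        with True show ?thesis using pos w_less by auto
      next
        case False
        then have "f m \<notin> {w1, w2, w3, w4}"
          unfolding set_w by (auto simp: f_eq)
        then have "\<exists>y\<in>{0..4}. grid n w ! y < f m \<and> f m < grid n w ! (y + 1)"
          using range[OF m] by (simp add: atLeastAtMost_0_4 grid_def w) linarith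
        then obtain y where y: "y \<in> {0..4}" "grid n w ! y < f m" "f m < grid n w ! (y + 1)"
          by blast
        have "\<exists>x\<in>{0..4}. grid n ?is ! x < m \<and> m < grid n ?is ! (x + 1)"
          using m False by (simp add: atLeastAtMost_0_4 grid_def) linarith
        then obtain x where x: "x \<in> {0..4}" "grid n ?is ! x < m" "m < grid n ?is ! (x + 1)"
          by blast
        have "(x, y) \<notin> R"
          using A m x(2,3) y(2,3) ent[OF m] by fastforce
        then have "x \<in> {1, 2, 3}" "y \<in> {1, 2, 3}"
          using x(1) y(1) by (auto simp: R_def)
        then have "i < m" "m < l" "w1 < f m" "f m < w4"
          using x(2,3) y(2,3) pos w_less by (auto simp: grid_def w)
        then show ?thesis by simp
      qed
      \<comment> \<open>Applying \<open>inside\<close> to the preimages of 1 and n pins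
        \<open>w1\<close> and \<open>w4\<close>; applying it to the positions 1 and n pins
        \<open>i\<close> and \<open>l\<close>.\<close>
      have "1 \<in> f ` {1..n}" "n \<in> f ` {1..n}"
        unfolding permutes_image[OF f] using pos by auto
      then have "w1 = 1" "w4 = n"
        using inside w_range by (force)+
      then show ?B
        using inside[of 1] inside[of n] pos by auto
    next
      assume ?B
      then show ?A
        using range by (fastforce simp: R_def atLeastAtMost_0_4 grid_def w ent)
    qed
    have extremal: "w1 = 1 \<and> w4 = n \<longleftrightarrow> {1, n} \<subseteq> f ` {i, j, k, l}"
      unfolding set_w[symmetric] using w_less w_range by auto
    have "length ?is = 4" "sorted_wrt (<) ?is" "set ?is \<subseteq> {1..n}"
      using pos by auto
    moreover have "1 < j \<and> j < k \<and> k < n" if "i = 1" "l = n"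
      using that pos by simp
    ultimately show ?thesis
      unfolding occurrence_def Let_def prod.case w_def[symmetric] len len_\<tau> order shade
      using extremal by blast
  qed
  show ?thesis
  proof (cases "1 \<le> i \<and> i < j \<and> j < k \<and> k < l \<and> l \<le> n")
    case True
    then show ?thesis
      using main by (simp only: \<tau>_def)
  next
    case False
    have "sorted_wrt (<) ?is" "set ?is \<subseteq> {1..n}" if "occurrence (\<pi>, R) \<tau> ?is"
      using that unfolding occurrence_def Let_def prod.case len_\<tau> by blast+
    then have "\<not> occurrence (\<pi>, R) \<tau> ?is"
      using False by auto
    moreover have "\<not> (i = 1 \<and> l = n \<and> 1 < j \<and> j < k \<and> k < n)"
      using False by auto
    ultimately show ?thesis
      unfolding \<tau>_def[symmetric] by blast
  qed
qed

text \<open>An occurrence has exactly four positions and the outer two are forced, so only the inner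
  positions \<open>j\<close> and \<open>k\<close> remain quantified.\<close>

lemma contains_boundary_iff:
  fixes \<pi> :: "nat list"
  defines "R \<equiv> ({0, 4} \<times> {0..4}) \<union> ({0..4} \<times> {0, 4})"
  assumes f: "f permutes {1..n}" and len: "length \<pi> = 4"
  shows "contains (map f [1..<Suc n]) (\<pi>, R) \<longleftrightarrow>
    (\<exists>j k. 1 < j \<and> j < k \<and> k < n \<and> {1, n} \<subseteq> f ` {1, j, k, n} \<and>
       (\<forall>a<4. \<forall>b<4. f ([1, j, k, n] ! a) < f ([1, j, k, n] ! b) \<longleftrightarrow> \<pi> ! a < \<pi> ! b))"
    (is "_ \<longleftrightarrow> ?rhs")
proof -
  have "contains (map f [1..<Suc n]) (\<pi>, R) \<longleftrightarrow>
      (\<exists>i j k l. occurrence (\<pi>, R) (map f [1..<Suc n]) [i, j, k, l])"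
  proof
    assume "contains (map f [1..<Suc n]) (\<pi>, R)"
    then obtain "is" where occ: "occurrence (\<pi>, R) (map f [1..<Suc n]) is"
      by (auto simp: contains_def)
    then have "length is = 4"
      using len by (simp add: occurrence_def Let_def del: upt_Suc)
    then obtain i j k l where "is = [i, j, k, l]"
      by (auto simp: length_Suc_conv numeral_eq_Suc)
    then show "\<exists>i j k l. occurrence (\<pi>, R) (map f [1..<Suc n]) [i, j, k, l]"
      using occ by blast
  qed (auto simp: contains_def)
  also have "\<dots> \<longleftrightarrow> ?rhs"
    unfolding R_def occurrence_boundary_iff[OF f len] by auto
  finally show ?thesis .
qed

section \<open>Counting by outer entries and extremal positions\<close>

text \<open>The same set serves for pairs of values, \<open>(f 1, f n)\<close>, and for pairs of
  positions, those of 1 and n. The strict bounds say that the outer entries are not extremal and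
  that the extremal entries are not outer.\<close>

definition increasing_pairs :: "nat \<Rightarrow> (nat \<times> nat) set" where
  "increasing_pairs n = {(a, b). 1 < a \<and> a < b \<and> b < n}"

definition decreasing_pairs :: "nat \<Rightarrow> (nat \<times> nat) set" where
  "decreasing_pairs n = prod.swap ` increasing_pairs n"

lemma finite_increasing_pairs: "finite (increasing_pairs n)"
  by (rule finite_subset[of _ "{..n} \<times> {..n}"]) (auto simp: increasing_pairs_def)

text \<open>Forgetting the order identifies these pairs with the 2-subsets of
  \<open>{2..<n}\<close>; the inverse sorts by \<open>min\<close> and \<open>max\<close>.\<close>

lemma card_increasing_pairs: "card (increasing_pairs n) = (n - 2) choose 2"
proof -
  have "bij_betw (\<lambda>(a, b). {a, b}) (increasing_pairs n) {B. B \<subseteq> {2..<n} \<and> card B = 2}"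
  proof (rule bij_betw_imageI)
    show "inj_on (\<lambda>(a, b). {a, b}) (increasing_pairs n)"
      by (auto simp: inj_on_def increasing_pairs_def doubleton_eq_iff)
    show "(\<lambda>(a, b). {a, b}) ` increasing_pairs n = {B. B \<subseteq> {2..<n} \<and> card B = 2}"
    proof (intro equalityI subsetI)
      fix B assume "B \<in> {B. B \<subseteq> {2..<n} \<and> card B = 2}"
      then obtain a b where "B = {a, b}" "a \<noteq> b" "{a, b} \<subseteq> {2..<n}"
        by (auto simp: card_2_iff)
      then have "B = {min a b, max a b}" "(min a b, max a b) \<in> increasing_pairs n"
        by (auto simp: increasing_pairs_def min_def max_def)
      then show "B \<in> (\<lambda>(a, b). {a, b}) ` increasing_pairs n"
        by force
    qed (auto simp: increasing_pairs_def)
  qed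
  then have "card (increasing_pairs n) = card {B. B \<subseteq> {2..<n} \<and> card B = 2}"
    by (rule bij_betw_same_card)
  then show ?thesis
    by (simp add: n_subsets)
qed

lemma card_decreasing_pairs: "card (decreasing_pairs n) = (n - 2) choose 2"
  unfolding decreasing_pairs_def
  by (subst card_image) (simp_all add: card_increasing_pairs)

lemma mem_decreasing_pairs: "(a, b) \<in> decreasing_pairs n \<longleftrightarrow> 1 < b \<and> b < a \<and> a < n"
  by (force simp: decreasing_pairs_def increasing_pairs_def)

lemma bex_increasing_pairs:
  "(\<exists>(a, b)\<in>increasing_pairs n. P a b) \<longleftrightarrow> (\<exists>a b. 1 < a \<and> a < b \<and> b < n \<and> P a b)"
  by (auto simp: increasing_pairs_def)

text \<open>The smaller component is quantified first, to match the order \<open>j < k\<close> of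
  positions in \<open>contains_boundary_iff\<close>.\<close>

lemma bex_decreasing_pairs:
  "(\<exists>(a, b)\<in>decreasing_pairs n. P a b) \<longleftrightarrow> (\<exists>b a. 1 < b \<and> b < a \<and> a < n \<and> P a b)"
  by (auto simp: decreasing_pairs_def increasing_pairs_def)

text \<open>A choice of \<open>(a, b)\<close> in \<open>A\<close> and \<open>(j, k)\<close> in
  \<open>B\<close> prescribes \<open>f\<close> at four distinct positions with four distinct values,
  which leaves \<open>fact (n - 4)\<close> permutations. Different choices give disjoint classes:
  \<open>f\<close> determines its outer values, and injectivity determines the positions of 1 and
  n.\<close>

lemma card_permutes_outer_and_extremal_pairs:
  assumes A: "A \<in> {increasing_pairs n, decreasing_pairs n}"
    and B: "B \<in> {increasing_pairs n, decreasing_pairs n}"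
  shows "card {f. f permutes {1..n} \<and> (f 1, f n) \<in> A \<and> (\<exists>(j, k)\<in>B. f j = 1 \<and> f k = n)} =
    ((n - 2) choose 2)\<^sup>2 * fact (n - 4)"
proof -
  define F where "F = (\<lambda>((a, b), (j, k)).
    {f. f permutes {1..n} \<and> f 1 = a \<and> f n = b \<and> f j = 1 \<and> f k = n})"
  have AB: "1 < a \<and> 1 < b \<and> a < n \<and> b < n \<and> a \<noteq> b" if "(a, b) \<in> A \<union> B" for a b
    using that A B by (auto simp: increasing_pairs_def mem_decreasing_pairs)
  have fin: "finite A" "finite B"
    using A B finite_increasing_pairs by (auto simp: decreasing_pairs_def)
  have card_AB: "card A = (n - 2) choose 2" "card B = (n - 2) choose 2"
    using A B by (auto simp: card_increasing_pairs card_decreasing_pairs)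
  have card_F: "card (F z) = fact (n - 4)" if "z \<in> A \<times> B" for z
  proof -
    obtain a b j k where z: "z = ((a, b), (j, k))"
      by (metis surj_pair)
    have ab: "1 < a" "1 < b" "a < n" "b < n" "a \<noteq> b" and jk: "1 < j" "1 < k" "j < n" "k < n" "j \<noteq> k"
      using that AB by (auto simp: z)
    \<comment> \<open>The updates do not overwrite each other, since \<open>j\<close> and
      \<open>k\<close> are distinct and lie strictly between 1 and n.\<close>
    define g :: "nat \<Rightarrow> nat" where "g = id(1 := a, n := b, j := 1, k := n)"
    have g: "g 1 = a" "g n = b" "g j = 1" "g k = n"
      using jk by (auto simp: g_def)
    have "card {f. f permutes {1..n} \<and> (\<forall>x\<in>{1, n, j, k}. f x = g x)} =
        fact (card {1..n} - card {1, n, j, k})"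
    proof (rule card_permutes_prescribed)
      show "inj_on g {1, n, j, k}"
        using ab jk g by (auto simp: inj_on_def)
      show "g ` {1, n, j, k} \<subseteq> {1..n}"
        using ab jk g by auto
    qed (use jk in auto)
    also have "card {1, n, j, k} = 4"
      using jk by simp
    finally show ?thesis
      by (simp only: F_def z prod.case g ball_simps) (simp add: g)
  qed
  have "{f. f permutes {1..n} \<and> (f 1, f n) \<in> A \<and> (\<exists>(j, k)\<in>B. f j = 1 \<and> f k = n)} =
      (\<Union>z\<in>A \<times> B. F z)"
    by (auto simp: F_def)
  also have "card \<dots> = (\<Sum>z\<in>A \<times> B. card (F z))"
  proof (rule card_UN_disjoint)
    show "\<forall>z\<in>A \<times> B. finite (F z)"
      by (auto simp: F_def intro: finite_subset[OF _ finite_permutations[of "{1..n}"]])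
    show "\<forall>z\<in>A \<times> B. \<forall>z'\<in>A \<times> B. z \<noteq> z' \<longrightarrow> F z \<inter> F z' = {}"
      by (auto simp: F_def dest!: permutes_inj) (metis injD)+
  qed (use fin in auto)
  also have "\<dots> = ((n - 2) choose 2)\<^sup>2 * fact (n - 4)"
    by (simp add: card_F card_AB card_cartesian_product power2_eq_square)
  finally show ?thesis .
qed

section \<open>The four patterns in terms of pairs\<close>

lemma all_less_4: "(\<forall>a<4::nat. P a) \<longleftrightarrow> P 0 \<and> P 1 \<and> P 2 \<and> P 3"
  by (auto simp: numeral_eq_Suc less_Suc_eq)

text \<open>In all four patterns the outer entries are 2 and 3 and the inner entries are 1 and 4,
  each pair in either order. Two comparisons therefore determine the pattern, and the inner entries
  of an occurrence lie below and above both outer ones.\<close>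

lemma order_isomorphic_length_4_iff:
  fixes x y z w :: nat
  assumes "\<pi> \<in> {[2,1,4,3], [2,4,1,3], [3,1,4,2], [3,4,1,2 :: nat]}"
  shows "(\<forall>a<4. \<forall>b<4. [x, y, z, w] ! a < [x, y, z, w] ! b \<longleftrightarrow> \<pi> ! a < \<pi> ! b) \<longleftrightarrow>
    (if \<pi> ! 0 < \<pi> ! 3 then x < w else w < x) \<and>
    (if \<pi> ! 1 < \<pi> ! 2 then y < x \<and> y < w \<and> x < z \<and> w < z
     else z < x \<and> z < w \<and> x < y \<and> w < y)"
  using assms by (elim insertE emptyE; simp add: all_less_4; linarith)

text \<open>Here \<open>y\<close> is the strict minimum and \<open>z\<close> the strict maximum of
  the four, so 1 and n can only be attained there.\<close>

lemma extremal_values_iff: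
  fixes x y z w n :: nat
  assumes "{x, y, z, w} \<subseteq> {1..n}" "y < x" "y < w" "x < z" "w < z"
  shows "{1, n} \<subseteq> {x, y, z, w} \<longleftrightarrow> y = 1 \<and> z = n"
  using assms by auto

text \<open>The order of the outer pattern entries selects the pairs for \<open>(f 1, f n)\<close>,
  that of the inner ones the pairs for the positions of 1 and n. If the larger inner entry comes
  first, n stands before 1, so these positions form a decreasing pair.\<close>

lemma contains_boundary_iff_pairs:
  fixes \<pi> :: "nat list"
  defines "R \<equiv> ({0, 4} \<times> {0..4}) \<union> ({0..4} \<times> {0, 4})"
  assumes f: "f permutes {1..n}"
    and \<pi>: "\<pi> \<in> {[2,1,4,3], [2,4,1,3], [3,1,4,2], [3,4,1,2]}"
  shows "contains (map f [1..<Suc n]) (\<pi>, R) \<longleftrightarrow>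
    (f 1, f n) \<in> (if \<pi> ! 0 < \<pi> ! 3 then increasing_pairs n else decreasing_pairs n) \<and>
    (\<exists>(j, k) \<in> (if \<pi> ! 1 < \<pi> ! 2 then increasing_pairs n else decreasing_pairs n).
       f j = 1 \<and> f k = n)"
proof -
  have range: "1 \<le> f m \<and> f m \<le> n" if "1 \<le> m" "m \<le> n" for m
    using permutes_in_image[OF f, of m] that by simp
  have f_eq: "f x = f y \<longleftrightarrow> x = y" for x y
    using permutes_inj[OF f] by (auto dest: injD)
  have len: "length \<pi> = 4"
    using \<pi> by auto
  have pair: "{1, n} \<subseteq> f ` {1, j, k, n} \<and>
      (\<forall>a<4. \<forall>b<4. f ([1, j, k, n] ! a) < f ([1, j, k, n] ! b) \<longleftrightarrow> \<pi> ! a < \<pi> ! b) \<longleftrightarrow>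
      (f 1, f n) \<in> (if \<pi> ! 0 < \<pi> ! 3 then increasing_pairs n else decreasing_pairs n) \<and>
      (if \<pi> ! 1 < \<pi> ! 2 then f j = 1 \<and> f k = n else f j = n \<and> f k = 1)"
    if jk: "1 < j" "j < k" "k < n" for j k
  proof -
    define x y z w where xyzw: "x = f 1" "y = f j" "z = f k" "w = f n"
    have bounds: "{x, y, z, w} \<subseteq> {1..n}"
      using range jk by (auto simp: xyzw)
    have distinct: "x \<noteq> y" "x \<noteq> z" "y \<noteq> w" "z \<noteq> w"
      using jk by (auto simp: f_eq xyzw)
    \<comment> \<open>Once the inner points take the values 1 and n, injectivity keeps the outer
      values strictly between; this yields both the strict bounds of the pairs and the comparisons
      between outer and inner entries.\<close>
    have inside: "1 < x \<and> 1 < w \<and> x < n \<and> w < n"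
      if "y = 1 \<and> z = n \<or> y = n \<and> z = 1"
      using that bounds distinct by auto
    have "{1, n} \<subseteq> {x, y, z, w} \<and>
      (\<forall>a<4. \<forall>b<4. [x, y, z, w] ! a < [x, y, z, w] ! b \<longleftrightarrow> \<pi> ! a < \<pi> ! b) \<longleftrightarrow>
      (x, w) \<in> (if \<pi> ! 0 < \<pi> ! 3 then increasing_pairs n else decreasing_pairs n) \<and>
      (if \<pi> ! 1 < \<pi> ! 2 then y = 1 \<and> z = n else y = n \<and> z = 1)"
    proof (cases "\<pi> ! 1 < \<pi> ! 2")
      case True
      then show ?thesis
        unfolding order_isomorphic_length_4_iff[OF \<pi>]
        using extremal_values_iff[OF bounds] inside
        by (auto simp: increasing_pairs_def mem_decreasing_pairs)
    next
      case False
      \<comment> \<open>Now \<open>z\<close> is the minimum and \<open>y\<close> the maximum, so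
        \<open>extremal_values_iff\<close> is used with these two exchanged.\<close>
      have bounds': "{x, z, y, w} \<subseteq> {1..n}"
        using bounds by auto
      show ?thesis
        unfolding order_isomorphic_length_4_iff[OF \<pi>]
        using False extremal_values_iff[OF bounds'] inside
        by (auto simp: increasing_pairs_def mem_decreasing_pairs)
    qed
    then show ?thesis
      unfolding all_less_4 xyzw by (simp add: insert_commute)
  qed
  show ?thesis
    unfolding R_def contains_boundary_iff[OF f len]
    by (simp only: pair bex_increasing_pairs bex_decreasing_pairs split: if_split cong: conj_cong) blast
qed

section \<open>The exact count and its asymptotic proportion\<close>

theorem theorem4p1:
  fixes \<pi> :: "nat list" and R :: "(nat \<times> nat) set" and p :: mesh_pattern
  assumes "\<pi> \<in> {[2,1,4,3], [2,4,1,3], [3,1,4,2], [3,4,1,2]}"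
    and "R = ({0, 4} \<times> {0..4}) \<union> ({0..4} \<times> {0, 4})"
    and "p = (\<pi>, R)"
  shows "(\<forall>n\<ge>4. num_containing n p = ((n - 2) choose 2)\<^sup>2 * fact (n - 4)) \<and>
         (\<lambda>n. real (num_containing n p) / fact n) \<longlonglongrightarrow> 1 / 4"
proof
  show count: "\<forall>n\<ge>4. num_containing n p = ((n - 2) choose 2)\<^sup>2 * fact (n - 4)"
  proof (intro allI impI)
    fix n :: nat
    define A where "A = (if \<pi> ! 0 < \<pi> ! 3 then increasing_pairs n else decreasing_pairs n)"
    define B where "B = (if \<pi> ! 1 < \<pi> ! 2 then increasing_pairs n else decreasing_pairs n)"
    have "num_containing n p =
        card {f. f permutes {1..n} \<and> (f 1, f n) \<in> A \<and> (\<exists>(j, k)\<in>B. f j = 1 \<and> f k = n)}"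
      unfolding num_containing_eq_card_permutes assms(2,3) A_def B_def
      using contains_boundary_iff_pairs[OF _ assms(1)]
      by (intro arg_cong[where f = card] Collect_cong conj_cong refl) blast
    also have "\<dots> = ((n - 2) choose 2)\<^sup>2 * fact (n - 4)"
      by (rule card_permutes_outer_and_extremal_pairs) (auto simp: A_def B_def)
    finally show "num_containing n p = ((n - 2) choose 2)\<^sup>2 * fact (n - 4)" .
  qed
  have "real (num_containing n p) / fact n =
      (real n - 2) * (real n - 3) / (4 * real n * (real n - 1))" if "n \<ge> 4" for n
  proof -
    \<comment> \<open>Substituting \<open>m + 4\<close> for \<open>n\<close> removes the truncated
      subtractions and lets four factors split off from \<open>fact n\<close>.\<close>
    define m where "m = n - 4"
    have m: "n = m + 4"
      using that by (simp add: m_def)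
    have choose: "real ((m + 2) choose 2) = (real m + 2) * (real m + 1) / 2"
      by (simp add: choose_two real_of_nat_div algebra_simps)
    have "real (num_containing n p) = ((real m + 2) * (real m + 1) / 2)\<^sup>2 * fact m"
      using count choose by (simp add: m)
    moreover have "fact n = (real m + 4) * (real m + 3) * (real m + 2) * (real m + 1) * fact m"
      by (simp add: m numeral_eq_Suc algebra_simps)
    \<comment> \<open>Here \<open>F\<close> stands for \<open>fact m\<close>, so that the
      cancellation is an identity of real rational functions with nonzero denominators.\<close>
    moreover have cancel: "((x + 2) * (x + 1) / 2)\<^sup>2 * F / ((x + 4) * (x + 3) * (x + 2) * (x + 1) * F) =
        (x + 2) * (x + 1) / (4 * (x + 4) * (x + 3))" if "x \<ge> 0" "F > 0" for x F :: real
      using that by (simp add: divide_simps power2_eq_square)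
    ultimately have "real (num_containing n p) / fact n =
        (real m + 2) * (real m + 1) / (4 * (real m + 4) * (real m + 3))"
      by (simp only: cancel of_nat_0_le_iff fact_gt_zero)
    then show ?thesis
      by (simp add: m add.commute)
  qed
  \<comment> \<open>The closed form holds from \<open>n = 4\<close> on, which suffices for the
    limit; its leading coefficients give 1/4.\<close>
  then have "eventually (\<lambda>n. (real n - 2) * (real n - 3) / (4 * real n * (real n - 1)) =
      real (num_containing n p) / fact n) sequentially"
    by (auto intro!: eventually_sequentiallyI[of 4])
  moreover have "(\<lambda>n. (real n - 2) * (real n - 3) / (4 * real n * (real n - 1))) \<longlonglongrightarrow> 1 / 4"
    by real_asymp
  ultimately show "(\<lambda>n. real (num_containing n p) / fact n) \<longlonglongrightarrow> 1 / 4"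
    by (rule Lim_transform_eventually[rotated])
qed

end
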